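(* Let $P$ be an infinite field, $X$ a finite set with $|X|>2$, and $F(X)$ the free Lie algebra over $P$ on $X$. If $\xi$ is a stable automorphism of the semigroup $\mathrm{End}(F(X))$ (i.e. $\xi$ acts identically on $\mathrm{Aut}(F(X))$), then $\xi$ acts identically on $\mathrm{End}(F(X))$.
   Context: $\mathrm{End}(F(X))$ is the semigroup of Lie $P$-algebra endomorphisms of $F(X)$, and $\mathrm{Aut}(F(X))$ is its group of invertible elements. *)

theory Defs
  imports Complex_Main "HOL-Library.Cardinality" "HOL-Algebra.Group"
begin

locale lie_algebra = vector_space scale
  for scale :: "'p::field \<Rightarrow> 'v::ab_group_add \<Rightarrow> 'v" +
  fixes bracket :: "'v \<Rightarrow> 'v \<Rightarrow> 'v"
  assumes bracket_add_left: "bracket (x + y) z = bracket x z + bracket y z"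
    and bracket_add_right: "bracket x (y + z) = bracket x y + bracket x z"
    and bracket_scale_left: "bracket (scale a x) y = scale a (bracket x y)"
    and bracket_scale_right: "bracket x (scale a y) = scale a (bracket x y)"
    and bracket_self: "bracket x x = 0"
    and jacobi: "bracket x (bracket y z) + bracket y (bracket z x) + bracket z (bracket x y) = 0"

definition lie_hom ::
  "('p::field \<Rightarrow> 'v::ab_group_add \<Rightarrow> 'v) \<Rightarrow> ('v \<Rightarrow> 'v \<Rightarrow> 'v) \<Rightarrow>
   ('p \<Rightarrow> 'w::ab_group_add \<Rightarrow> 'w) \<Rightarrow> ('w \<Rightarrow> 'w \<Rightarrow> 'w) \<Rightarrow> ('v \<Rightarrow> 'w) \<Rightarrow> bool"
  where "lie_hom s1 b1 s2 b2 f \<longleftrightarrow>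
    Vector_Spaces.linear s1 s2 f \<and> (\<forall>x y. f (b1 x y) = b2 (f x) (f y))"

text \<open>
  The free Lie algebra on the set of all elements of \<open>'x\<close>: terms in the signature of Lie
  algebras over \<open>'p\<close>, modulo the congruence generated by the Lie algebra axioms.
\<close>

datatype ('p, 'x) lie_term =
    Gen 'x
  | Zero
  | Add "('p, 'x) lie_term" "('p, 'x) lie_term"
  | Neg "('p, 'x) lie_term"
  | Scale 'p "('p, 'x) lie_term"
  | Bracket "('p, 'x) lie_term" "('p, 'x) lie_term"

inductive lie_eq :: "('p::field, 'x) lie_term \<Rightarrow> ('p, 'x) lie_term \<Rightarrow> bool" where
  refl: "lie_eq s s"
| sym: "lie_eq s t \<Longrightarrow> lie_eq t s"
| trans: "lie_eq s t \<Longrightarrow> lie_eq t u \<Longrightarrow> lie_eq s u"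
| cong_Add: "lie_eq s s' \<Longrightarrow> lie_eq t t' \<Longrightarrow> lie_eq (Add s t) (Add s' t')"
| cong_Neg: "lie_eq s s' \<Longrightarrow> lie_eq (Neg s) (Neg s')"
| cong_Scale: "lie_eq s s' \<Longrightarrow> lie_eq (Scale a s) (Scale a s')"
| cong_Bracket: "lie_eq s s' \<Longrightarrow> lie_eq t t' \<Longrightarrow> lie_eq (Bracket s t) (Bracket s' t')"
| add_assoc: "lie_eq (Add (Add s t) u) (Add s (Add t u))"
| add_commute: "lie_eq (Add s t) (Add t s)"
| add_zero: "lie_eq (Add Zero s) s"
| add_neg: "lie_eq (Add (Neg s) s) Zero"
| scale_add_right: "lie_eq (Scale a (Add s t)) (Add (Scale a s) (Scale a t))"
| scale_add_left: "lie_eq (Scale (a + b) s) (Add (Scale a s) (Scale b s))"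
| scale_scale: "lie_eq (Scale a (Scale b s)) (Scale (a * b) s)"
| scale_one: "lie_eq (Scale 1 s) s"
| bracket_add_left: "lie_eq (Bracket (Add s t) u) (Add (Bracket s u) (Bracket t u))"
| bracket_add_right: "lie_eq (Bracket s (Add t u)) (Add (Bracket s t) (Bracket s u))"
| bracket_scale_left: "lie_eq (Bracket (Scale a s) t) (Scale a (Bracket s t))"
| bracket_scale_right: "lie_eq (Bracket s (Scale a t)) (Scale a (Bracket s t))"
| bracket_self: "lie_eq (Bracket s s) Zero"
| jacobi: "lie_eq (Add (Add (Bracket s (Bracket t u)) (Bracket t (Bracket u s)))
                       (Bracket u (Bracket s t))) Zero"

quotient_type (overloaded) ('p, 'x) free_lie = "('p::field, 'x) lie_term" / lie_eq
  by (intro equivpI reflpI sympI transpI) (blast intro: lie_eq.intros)+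

lift_definition fl_gen :: "'x \<Rightarrow> ('p::field, 'x) free_lie" is Gen .

lift_definition fl_scale :: "'p::field \<Rightarrow> ('p, 'x) free_lie \<Rightarrow> ('p, 'x) free_lie" is Scale
  by (rule lie_eq.cong_Scale)

lift_definition fl_bracket ::
  "('p::field, 'x) free_lie \<Rightarrow> ('p, 'x) free_lie \<Rightarrow> ('p, 'x) free_lie" is Bracket
  by (rule lie_eq.cong_Bracket)

instantiation free_lie :: (field, type) ab_group_add
begin

lift_definition zero_free_lie :: "('a, 'b) free_lie" is Zero .

lift_definition plus_free_lie ::
  "('a, 'b) free_lie \<Rightarrow> ('a, 'b) free_lie \<Rightarrow> ('a, 'b) free_lie" is Add
  by (rule lie_eq.cong_Add)

lift_definition uminus_free_lie :: "('a, 'b) free_lie \<Rightarrow> ('a, 'b) free_lie" is Neg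
  by (rule lie_eq.cong_Neg)

definition minus_free_lie :: "('a, 'b) free_lie \<Rightarrow> ('a, 'b) free_lie \<Rightarrow> ('a, 'b) free_lie"
  where "minus_free_lie x y = x + - y"

instance
proof
  fix a b c :: "('a, 'b) free_lie"
  show "a + b + c = a + (b + c)" by transfer (rule lie_eq.add_assoc)
  show "a + b = b + a" by transfer (rule lie_eq.add_commute)
  show "0 + a = a" by transfer (rule lie_eq.add_zero)
  show "- a + a = 0" by transfer (rule lie_eq.add_neg)
  show "a - b = a + - b" by (rule minus_free_lie_def)
qed

end

interpretation free_lie: lie_algebra
  "fl_scale :: 'p::field \<Rightarrow> ('p, 'x) free_lie \<Rightarrow> ('p, 'x) free_lie" fl_bracket
proof unfold_locales
  fix a b :: 'p and x y z :: "('p, 'x) free_lie"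
  show "fl_scale a (x + y) = fl_scale a x + fl_scale a y"
    by transfer (rule lie_eq.scale_add_right)
  show "fl_scale (a + b) x = fl_scale a x + fl_scale b x"
    by transfer (rule lie_eq.scale_add_left)
  show "fl_scale a (fl_scale b x) = fl_scale (a * b) x"
    by transfer (rule lie_eq.scale_scale)
  show "fl_scale 1 x = x"
    by transfer (rule lie_eq.scale_one)
  show "fl_bracket (x + y) z = fl_bracket x z + fl_bracket y z"
    by transfer (rule lie_eq.bracket_add_left)
  show "fl_bracket x (y + z) = fl_bracket x y + fl_bracket x z"
    by transfer (rule lie_eq.bracket_add_right)
  show "fl_bracket (fl_scale a x) y = fl_scale a (fl_bracket x y)"
    by transfer (rule lie_eq.bracket_scale_left)
  show "fl_bracket x (fl_scale a y) = fl_scale a (fl_bracket x y)"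
    by transfer (rule lie_eq.bracket_scale_right)
  show "fl_bracket x x = 0"
    by transfer (rule lie_eq.bracket_self)
  show "fl_bracket x (fl_bracket y z) + fl_bracket y (fl_bracket z x)
      + fl_bracket z (fl_bracket x y) = 0"
    by transfer (rule lie_eq.jacobi)
qed

context lie_algebra
begin

primrec eval_term :: "('x \<Rightarrow> 'v) \<Rightarrow> ('p, 'x) lie_term \<Rightarrow> 'v" where
  "eval_term g (Gen x) = g x"
| "eval_term g Zero = 0"
| "eval_term g (Add s t) = eval_term g s + eval_term g t"
| "eval_term g (Neg s) = - eval_term g s"
| "eval_term g (Scale a s) = scale a (eval_term g s)"
| "eval_term g (Bracket s t) = bracket (eval_term g s) (eval_term g t)"

lemma eval_term_cong: "lie_eq s t \<Longrightarrow> eval_term g s = eval_term g t"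
  by (induction rule: lie_eq.induct)
    (simp_all add: bracket_add_left bracket_add_right bracket_scale_left bracket_scale_right
      bracket_self jacobi scale_right_distrib scale_left_distrib)

text \<open>The universal property: \<open>free_lie\<close> is free on the generators \<open>fl_gen\<close>.\<close>

theorem free_lie_universal:
  fixes g :: "'x \<Rightarrow> 'v"
  shows "\<exists>!f. lie_hom fl_scale fl_bracket scale bracket f \<and> (\<forall>x. f (fl_gen x) = g x)"
proof -
  define f where "f u = eval_term g (rep_free_lie u)" for u
  have f_abs: "f (abs_free_lie t) = eval_term g t" for t
    unfolding f_def by (rule eval_term_cong)
      (metis Quotient3_abs_rep Quotient3_free_lie free_lie.abs_eq_iff)
  have ops: "f (u + v) = f u + f v" "f (fl_scale a u) = scale a (f u)"
    "f (fl_bracket u v) = bracket (f u) (f v)" for a u v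
    by (induct u; induct v;
        simp add: plus_free_lie.abs_eq fl_scale.abs_eq fl_bracket.abs_eq f_abs)+
  have "lie_hom fl_scale fl_bracket scale bracket f"
    unfolding lie_hom_def
    by (auto intro!: Vector_Spaces.linear.intro module_hom.intro module_hom_axioms.intro
        vector_space_axioms free_lie.vector_space_axioms module_axioms free_lie.module_axioms
        simp: ops)
  moreover have "f (fl_gen x) = g x" for x
    by (simp add: fl_gen.abs_eq f_abs)
  moreover have "h = f" if h: "lie_hom fl_scale fl_bracket scale bracket h"
    and hg: "\<forall>x. h (fl_gen x) = g x" for h
  proof
    from h interpret h: Vector_Spaces.linear fl_scale scale h by (simp add: lie_hom_def)
    have hb: "h (fl_bracket u v) = bracket (h u) (h v)" for u v
      using h by (simp add: lie_hom_def)
    have "h (abs_free_lie t) = eval_term g t" for t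
    proof (induction t)
      case (Gen x)
      then show ?case using hg by (simp flip: fl_gen.abs_eq)
    next
      case Zero
      then show ?case using h.zero by (simp flip: zero_free_lie_def)
    next
      case (Add s t)
      then show ?case by (simp flip: plus_free_lie.abs_eq add: h.add)
    next
      case (Neg s)
      then show ?case by (simp flip: uminus_free_lie.abs_eq add: h.neg)
    next
      case (Scale a s)
      then show ?case by (simp flip: fl_scale.abs_eq add: h.scale)
    next
      case (Bracket s t)
      then show ?case by (simp flip: fl_bracket.abs_eq add: hb)
    qed
    then show "h u = f u" for u
      by (induct u) (simp add: f_abs)
  qed
  ultimately show ?thesis by blast
qed

end

definition free_lie_End :: "(('p::field, 'x) free_lie \<Rightarrow> ('p, 'x) free_lie) monoid"
  where "free_lie_End =
    \<lparr>carrier = {f. lie_hom fl_scale fl_bracket fl_scale fl_bracket f}, mult = (\<circ>), one = id\<rparr>"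

lemma monoid_free_lie_End: "monoid free_lie_End"
  by (rule monoidI)
    (auto simp: free_lie_End_def lie_hom_def free_lie.linear_id
      intro: Vector_Spaces.linear_compose)

end

theory Submission
  imports Defs "HOL-Computational_Algebra.Polynomial" "HOL-Combinatorics.Transposition"
begin

text \<open>
  Fix a generator \<open>x\<close>, and encode an element \<open>u\<close> of the free Lie algebra as the endomorphism
  \<open>single x u\<close> that sends \<open>x\<close> to \<open>u\<close> and the other generators to \<open>0\<close>. These are the endomorphisms
  \<open>f\<close> with \<open>f \<circ> e = f\<close>, where \<open>e = single x x\<close> is the projection onto \<open>x\<close>, and composing with an
  endomorphism on the left amounts to applying it: \<open>\<phi> \<circ> single x u = single x (\<phi> u)\<close>.

  The first step is \<open>\<xi> e = e\<close> (lemma \<open>xi_projection\<close>). The diagonal automorphisms that fix \<open>x\<close> and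
  multiply the other generators by \<open>b \<noteq> 0\<close> leave \<open>e\<close> unchanged when composed with it on either side,
  so they leave \<open>\<xi> e\<close> unchanged too. Hence \<open>\<xi> e\<close> kills the other generators, and \<open>v = \<xi> e x\<close> is fixed
  by all these automorphisms. The image of \<open>v\<close> depends polynomially on \<open>b\<close> and the field is infinite,
  so the case \<open>b = 0\<close> yields \<open>e v = v\<close>, and \<open>v\<close> is a scalar multiple of \<open>x\<close>. Since \<open>\<xi> e\<close> is an
  idempotent, it is \<open>0\<close> or \<open>e\<close>, and the former occurs only if \<open>e = 0\<close>. This argument needs neither
  a grading nor a basis of the free Lie algebra.

  Consequently \<open>\<xi> (single x u) = single x (s u)\<close> for a map \<open>s\<close> (called \<open>action x\<close> below), and
  \<open>\<xi> \<phi> (s u) = s (\<phi> u)\<close> for every endomorphism \<open>\<phi>\<close>. Applied to automorphisms, this shows that \<open>s\<close>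
  fixes every element in the automorphism orbit of \<open>x\<close>. That orbit contains the generators, \<open>a x\<close> with
  \<open>a \<noteq> 0\<close>, \<open>x + y\<close> and \<open>x + [y, z]\<close>, and substituting arbitrary elements for the generators
  turns this into the statement that \<open>s\<close> preserves scaling, sums and brackets. So \<open>s\<close> is an
  endomorphism that fixes the generators, that is, the identity, and then \<open>\<xi> \<phi> = \<phi>\<close>.
\<close>


section \<open>Polynomial curves in a vector space\<close>

text \<open>Maps \<open>a \<mapsto> v\<^sub>0 + a v\<^sub>1 + \<dots> + a\<^sup>n v\<^sub>n\<close> from the field of scalars to the vector space,
  generated in the manner of Horner's scheme.\<close>

inductive poly_curve :: "('p \<Rightarrow> 'v \<Rightarrow> 'v::ab_group_add) \<Rightarrow> ('p \<Rightarrow> 'v) \<Rightarrow> bool"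
  for s where
  const: "poly_curve s (\<lambda>a. v)"
| add: "poly_curve s f \<Longrightarrow> poly_curve s g \<Longrightarrow> poly_curve s (\<lambda>a. f a + g a)"
| shift: "poly_curve s f \<Longrightarrow> poly_curve s (\<lambda>a. s a (f a))"

lemma (in vector_space) poly_curve_scale:
  "poly_curve scale f \<Longrightarrow> poly_curve scale (\<lambda>a. scale c (f a))"
proof (induction rule: poly_curve.induct)
  case (add f g)
  then show ?case by (simp add: scale_right_distrib poly_curve.add)
next
  case (shift f)
  then show ?case
    using poly_curve.shift[OF shift.IH] by (simp only: scale_scale mult.commute[of c])
qed (rule poly_curve.const)

lemma (in vector_space) poly_curve_representation:
  assumes "independent B" "span B = UNIV" "poly_curve scale f"
  shows "\<exists>p. \<forall>a. representation B (f a) b = poly p a"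
  using assms(3)
proof (induction rule: poly_curve.induct)
  case (const v)
  show ?case by (rule exI[of _ "[:representation B v b:]"]) simp
next
  case (add f g)
  then obtain p q where "\<forall>a. representation B (f a) b = poly p a"
    "\<forall>a. representation B (g a) b = poly q a" by auto
  then show ?case
    using assms(1,2) by (intro exI[of _ "p + q"]) (simp add: representation_add)
next
  case (shift f)
  then obtain p where "\<forall>a. representation B (f a) b = poly p a" by auto
  then show ?case
    using assms(1,2) by (intro exI[of _ "pCons 0 p"]) (simp add: representation_scale)
qed

text \<open>Over an infinite field, the nonzero scalars are Zariski dense: a polynomial curve that takes
  the same value at all of them takes it at \<open>0\<close> as well. Coordinatewise, this says that a
  polynomial with infinitely many roots vanishes.\<close>

lemma (in vector_space) poly_curve_constant_at_0:
  assumes inf: "infinite (UNIV :: 'a set)"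
    and f: "poly_curve scale f"
    and v: "\<And>a. a \<noteq> 0 \<Longrightarrow> f a = v"
  shows "f 0 = v"
proof -
  define B where "B = extend_basis {}"
  have B: "independent B" "span B = UNIV"
    by (simp_all add: B_def independent_extend_basis independent_empty span_extend_basis)
  have "representation B (f 0) b = representation B v b" for b
  proof -
    obtain p where p: "\<forall>a. representation B (f a) b = poly p a"
      using poly_curve_representation[OF B f, of b] by auto
    define q where "q = p - [:representation B v b:]"
    have "poly q a = 0" if "a \<noteq> 0" for a
      using p[rule_format, of a] v[OF that] by (simp add: q_def)
    then have "UNIV - {0} \<subseteq> {a. poly q a = 0}" by auto
    moreover have "infinite (UNIV - {0 :: 'a})" using inf by simp
    ultimately have "infinite {a. poly q a = 0}" by (rule infinite_super)
    then have "q = 0" using poly_roots_finite[of q] by auto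
    then have "p = [:representation B v b:]" by (simp add: q_def)
    then show ?thesis using p[rule_format, of 0] by simp
  qed
  then have rep: "representation B (f 0) = representation B v" by (rule ext)
  have sum: "(\<Sum>b | representation B w b \<noteq> 0. scale (representation B w b) b) = w" for w
    by (rule sum_nonzero_representation_eq) (simp_all add: B)
  show ?thesis
    using sum[of "f 0"] unfolding rep sum[of v] by simp
qed

lemma (in lie_algebra) poly_curve_bracket:
  assumes "poly_curve scale f" "poly_curve scale g"
  shows "poly_curve scale (\<lambda>a. bracket (f a) (g a))"
  using assms(1)
proof (induction rule: poly_curve.induct)
  case (const v)
  show ?case
    using assms(2)
  proof (induction rule: poly_curve.induct)
    case (shift f)
    then show ?case using poly_curve.shift[OF shift.IH] by (simp add: bracket_scale_right)
  qed (simp_all add: bracket_add_right poly_curve.const poly_curve.add)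
next
  case (shift f)
  then show ?case using poly_curve.shift[OF shift.IH] by (simp add: bracket_scale_left)
qed (simp add: bracket_add_left poly_curve.add)


section \<open>Endomorphisms of the free Lie algebra\<close>

lemma free_lie_induct [case_names gen zero add scale bracket]:
  fixes u :: "('p::field, 'x) free_lie"
  assumes gen: "\<And>x. Q (fl_gen x)" and zero: "Q 0"
    and add: "\<And>u v. Q u \<Longrightarrow> Q v \<Longrightarrow> Q (u + v)"
    and scale: "\<And>a u. Q u \<Longrightarrow> Q (fl_scale a u)"
    and bracket: "\<And>u v. Q u \<Longrightarrow> Q v \<Longrightarrow> Q (fl_bracket u v)"
  shows "Q u"
proof -
  have "Q (abs_free_lie t)" for t
  proof (induction t)
    case (Gen x)
    then show ?case using gen by (simp flip: fl_gen.abs_eq)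
  next
    case Zero
    then show ?case using zero by (simp flip: zero_free_lie_def)
  next
    case (Add s t)
    then show ?case using add by (simp flip: plus_free_lie.abs_eq)
  next
    case (Neg s)
    then show ?case using scale[of _ "- 1"] by (simp flip: uminus_free_lie.abs_eq)
  next
    case (Scale a s)
    then show ?case using scale by (simp flip: fl_scale.abs_eq)
  next
    case (Bracket s t)
    then show ?case using bracket by (simp flip: fl_bracket.abs_eq)
  qed
  then show ?thesis by (induct u) 
qed

abbreviation fl_hom :: "(('p::field, 'x) free_lie \<Rightarrow> ('p, 'x) free_lie) \<Rightarrow> bool"
  where "fl_hom \<equiv> lie_hom fl_scale fl_bracket fl_scale fl_bracket"

lemma fl_homI:
  assumes "\<And>u v. f (u + v) = f u + f v" "\<And>a u. f (fl_scale a u) = fl_scale a (f u)"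
    and "\<And>u v. f (fl_bracket u v) = fl_bracket (f u) (f v)"
  shows "fl_hom f"
  unfolding lie_hom_def
  by (auto intro!: Vector_Spaces.linear.intro module_hom.intro module_hom_axioms.intro
      free_lie.vector_space_axioms free_lie.module_axioms simp: assms)

context
  fixes f :: "('p::field, 'x) free_lie \<Rightarrow> ('p, 'x) free_lie"
  assumes f: "fl_hom f"
begin

interpretation Vector_Spaces.linear fl_scale fl_scale f
  using f by (simp add: lie_hom_def)

lemma fl_hom_simps:
  "f 0 = 0" "f (u + v) = f u + f v" "f (u - v) = f u - f v" "f (- u) = - f u"
  "f (fl_scale a u) = fl_scale a (f u)"
  "f (fl_bracket u v) = fl_bracket (f u) (f v)"
  using f by (simp_all add: zero add diff neg scale lie_hom_def)

end

lemma fl_hom_eqI: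
  assumes "fl_hom f" "fl_hom g" "\<And>x. f (fl_gen x) = g (fl_gen x)"
  shows "f = g"
proof
  show "f u = g u" for u
    by (induction u rule: free_lie_induct) (simp_all add: assms fl_hom_simps)
qed

lemma fl_hom_compose: "fl_hom f \<Longrightarrow> fl_hom g \<Longrightarrow> fl_hom (f \<circ> g)"
  by (rule fl_homI) (simp_all add: fl_hom_simps)

text \<open>The endomorphism with prescribed values on the generators.\<close>

definition fl_lift :: "('x \<Rightarrow> ('p::field, 'x) free_lie) \<Rightarrow> ('p, 'x) free_lie \<Rightarrow> ('p, 'x) free_lie"
  where "fl_lift g = (THE f. fl_hom f \<and> (\<forall>x. f (fl_gen x) = g x))"

lemma fl_hom_lift: "fl_hom (fl_lift g)" and fl_lift_gen: "fl_lift g (fl_gen x) = g x"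
  using theI'[OF free_lie.free_lie_universal[of g]] by (simp_all add: fl_lift_def)

lemmas fl_lift_simps = fl_lift_gen fl_hom_simps[OF fl_hom_lift]

text \<open>If the images of the generators vary polynomially with a parameter, then so does the image of
  every element.\<close>

lemma poly_curve_fl_lift:
  assumes "\<And>x. poly_curve fl_scale (\<lambda>a. g a x)"
  shows "poly_curve fl_scale (\<lambda>a. fl_lift (g a) u)"
  by (induction u rule: free_lie_induct)
    (simp_all add: fl_lift_simps assms poly_curve.const poly_curve.add
      free_lie.poly_curve_scale free_lie.poly_curve_bracket)

lemma carrier_End [simp]: "f \<in> carrier free_lie_End \<longleftrightarrow> fl_hom f"
  and mult_End [simp]: "f \<otimes>\<^bsub>free_lie_End\<^esub> g = f \<circ> g"
  and one_End [simp]: "\<one>\<^bsub>free_lie_End\<^esub> = id"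
  by (simp_all add: free_lie_End_def)


section \<open>Some automorphisms\<close>

lemma fl_lift_Units:
  assumes "\<And>x. fl_lift g (h x) = fl_gen x" "\<And>x. fl_lift h (g x) = fl_gen x"
  shows "fl_lift g \<in> Units free_lie_End"
proof -
  have "fl_hom id" by (rule fl_homI) simp_all
  then have "fl_lift g \<circ> fl_lift h = id" "fl_lift h \<circ> fl_lift g = id"
    by (intro fl_hom_eqI fl_hom_compose fl_hom_lift; simp add: assms fl_lift_gen)+
  then show ?thesis
    unfolding Units_def by (auto intro!: exI[of _ "fl_lift h"] simp: fl_hom_lift)
qed

lemma diagonal_Units:
  assumes "\<And>x. d x \<noteq> 0"
  shows "fl_lift (\<lambda>x. fl_scale (d x) (fl_gen x)) \<in> Units free_lie_End"
  by (rule fl_lift_Units[where h = "\<lambda>x. fl_scale (inverse (d x)) (fl_gen x)"])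
    (simp_all add: fl_lift_simps assms)

lemma transpose_Units: "fl_lift (\<lambda>z. fl_gen (transpose x y z)) \<in> Units free_lie_End"
  by (rule fl_lift_Units[where h = "\<lambda>z. fl_gen (transpose x y z)"]) (simp_all add: fl_lift_simps)

text \<open>Adding \<open>u\<close> to the generator \<open>x\<close> is invertible if \<open>u\<close> does not involve \<open>x\<close>, in the sense that
  \<open>u\<close> is insensitive to any substitution for \<open>x\<close>.\<close>

lemma transvection_Units:
  assumes "\<And>w. fl_lift (fl_gen(x := w)) u = u"
  shows "fl_lift (fl_gen(x := fl_gen x + u)) \<in> Units free_lie_End"
  by (rule fl_lift_Units[where h = "fl_gen(x := fl_gen x + - u)"])
    (simp_all add: fl_lift_simps assms)


section \<open>Rank one endomorphisms\<close>

text \<open>The endomorphism that sends the generator \<open>x\<close> to \<open>u\<close> and kills the other generators. It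
  encodes the element \<open>u\<close> inside the semigroup of endomorphisms.\<close>

definition single :: "'x \<Rightarrow> ('p::field, 'x) free_lie \<Rightarrow> ('p, 'x) free_lie \<Rightarrow> ('p, 'x) free_lie"
  where "single x u = fl_lift (\<lambda>y. if y = x then u else 0)"

lemma fl_hom_single: "fl_hom (single x u)"
  by (simp add: single_def fl_hom_lift)

lemma single_gen: "single x u (fl_gen y) = (if y = x then u else 0)"
  by (simp add: single_def fl_lift_gen)

lemma single_eqI:
  assumes "fl_hom f" "\<And>y. y \<noteq> x \<Longrightarrow> f (fl_gen y) = 0"
  shows "f = single x (f (fl_gen x))"
  by (rule fl_hom_eqI) (simp_all add: assms fl_hom_single single_gen)

lemma single_0: "single x 0 u = 0"
  by (induction u rule: free_lie_induct)
    (simp_all add: single_gen fl_hom_simps[OF fl_hom_single] free_lie.bracket_self)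

lemma comp_single:
  assumes "fl_hom f"
  shows "f \<circ> single x u = single x (f u)"
  by (rule fl_hom_eqI)
    (simp_all add: assms fl_hom_compose fl_hom_single single_gen fl_hom_simps[OF assms])

text \<open>A Lie algebra generated by one element is at most one-dimensional.\<close>

lemma single_gen_multiple: "\<exists>c. single x (fl_gen x) u = fl_scale c (fl_gen x)"
proof (induction u rule: free_lie_induct)
  case (gen y)
  show ?case
    by (cases "y = x") (auto simp: single_gen intro: exI[of _ 0] exI[of _ 1])
next
  case zero
  show ?case by (auto simp: fl_hom_simps[OF fl_hom_single] intro: exI[of _ 0])
next
  case (add u v)
  then show ?case
    by (auto simp: fl_hom_simps[OF fl_hom_single] simp flip: free_lie.scale_left_distrib)
next
  case (scale a u)
  then show ?case by (auto simp: fl_hom_simps[OF fl_hom_single])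
next
  case (bracket u v)
  then show ?case
    by (auto simp: fl_hom_simps[OF fl_hom_single] free_lie.bracket_scale_left
        free_lie.bracket_scale_right free_lie.bracket_self intro: exI[of _ 0])
qed


section \<open>Stable automorphisms\<close>

text \<open>An automorphism of the semigroup of endomorphisms, over an infinite field, that acts
  identically on the group of invertible endomorphisms.\<close>

locale stable_automorphism =
  fixes \<xi> :: "(('p::field, 'x) free_lie \<Rightarrow> ('p, 'x) free_lie) \<Rightarrow>
              (('p, 'x) free_lie \<Rightarrow> ('p, 'x) free_lie)"
  assumes inf: "infinite (UNIV :: 'p set)"
    and iso: "\<xi> \<in> iso free_lie_End free_lie_End"
    and stable: "\<sigma> \<in> Units free_lie_End \<Longrightarrow> \<xi> \<sigma> = \<sigma>"
begin

lemma fl_hom_xi: "fl_hom f \<Longrightarrow> fl_hom (\<xi> f)"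
  using iso by (auto simp: iso_def hom_def)

lemma xi_comp: "fl_hom f \<Longrightarrow> fl_hom g \<Longrightarrow> \<xi> (f \<circ> g) = \<xi> f \<circ> \<xi> g"
  using iso by (auto simp: iso_def hom_def)

lemma xi_inj: "fl_hom f \<Longrightarrow> fl_hom g \<Longrightarrow> \<xi> f = \<xi> g \<Longrightarrow> f = g"
  using iso by (auto simp: iso_def bij_betw_def inj_on_def)

lemma xi_surj:
  assumes "fl_hom f"
  obtains g where "fl_hom g" "\<xi> g = f"
proof -
  have "f \<in> \<xi> ` carrier free_lie_End"
    using iso assms by (simp add: iso_def bij_betw_def)
  then show ?thesis using that by auto
qed

lemma fl_hom_Unit: "\<sigma> \<in> Units free_lie_End \<Longrightarrow> fl_hom \<sigma>"
  by (auto simp: Units_def)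

lemma xi_comp_Unit:
  assumes "fl_hom f" "\<sigma> \<in> Units free_lie_End" "f \<circ> \<sigma> = f"
  shows "\<xi> f (\<sigma> u) = \<xi> f u"
proof -
  have "\<xi> f \<circ> \<sigma> = \<xi> f"
    using xi_comp[OF assms(1) fl_hom_Unit[OF assms(2)]] unfolding assms(3) stable[OF assms(2)] ..
  then show ?thesis by (simp add: fun_eq_iff)
qed

lemma Unit_comp_xi:
  assumes "fl_hom f" "\<sigma> \<in> Units free_lie_End" "\<sigma> \<circ> f = f"
  shows "\<sigma> (\<xi> f u) = \<xi> f u"
proof -
  have "\<sigma> \<circ> \<xi> f = \<xi> f"
    using xi_comp[OF fl_hom_Unit[OF assms(2)] assms(1)] unfolding assms(3) stable[OF assms(2)] ..
  then show ?thesis by (simp add: fun_eq_iff)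
qed

text \<open>The zero endomorphism is the absorbing element of the semigroup.\<close>

lemma xi_zero: "\<xi> (single x 0) = single x 0"
proof -
  let ?z = "single x 0 :: ('p, 'x) free_lie \<Rightarrow> _"
  obtain g where g: "fl_hom g" "\<xi> g = ?z"
    by (rule xi_surj[OF fl_hom_single])
  have "?z \<circ> g = ?z" by (simp add: fun_eq_iff single_0)
  then have "\<xi> ?z = \<xi> (?z \<circ> g)" by simp
  also have "\<dots> = \<xi> ?z \<circ> ?z"
    unfolding xi_comp[OF fl_hom_single g(1)] g(2) ..
  also have "\<dots> = single x (\<xi> ?z 0)"
    by (rule comp_single[OF fl_hom_xi[OF fl_hom_single]])
  finally show ?thesis by (simp add: fl_hom_simps[OF fl_hom_xi[OF fl_hom_single]])
qed

text \<open>The diagonal automorphisms that stabilise the projection onto a generator determine its image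
  under \<open>\<xi>\<close> up to a scalar. Idempotency and injectivity of \<open>\<xi>\<close> fix the scalar.\<close>

lemma xi_projection: "\<xi> (single x (fl_gen x)) = single x (fl_gen x)"
proof -
  let ?e = "single x (fl_gen x) :: ('p, 'x) free_lie \<Rightarrow> _"
  define v where "v = \<xi> ?e (fl_gen x)"
  note hom_e = fl_hom_xi[OF fl_hom_single, of x "fl_gen x"]
  have "\<exists>a::'p. a \<notin> {0, 1}"
    using inf by (metis ex_new_if_finite finite.emptyI finite_insert)
  then obtain a :: 'p where a: "a \<noteq> 0" "a \<noteq> 1" by auto
  have "\<xi> ?e (fl_gen y) = 0" if "y \<noteq> x" for y
  proof -
    let ?\<tau> = "fl_lift (\<lambda>z. fl_scale (if z = x then 1 else a) (fl_gen z))"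
    have \<tau>: "?\<tau> \<in> Units free_lie_End" using a by (intro diagonal_Units) simp
    have "?e \<circ> ?\<tau> = ?e"
      by (intro fl_hom_eqI fl_hom_compose fl_hom_single fl_hom_lift)
        (simp add: fl_lift_simps single_gen fl_hom_simps[OF fl_hom_single])
    then have "\<xi> ?e (?\<tau> (fl_gen y)) = \<xi> ?e (fl_gen y)"
      by (rule xi_comp_Unit[OF fl_hom_single \<tau>])
    then have "fl_scale a (\<xi> ?e (fl_gen y)) = fl_scale 1 (\<xi> ?e (fl_gen y))"
      using that by (simp add: fl_lift_simps fl_hom_simps[OF hom_e])
    then show ?thesis using a(2) by (metis free_lie.scale_cancel_right)
  qed
  then have e: "\<xi> ?e = single x v"
    unfolding v_def by (rule single_eqI[OF hom_e])
  define \<sigma> :: "'p \<Rightarrow> ('p, 'x) free_lie \<Rightarrow> ('p, 'x) free_lie"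
    where "\<sigma> b = fl_lift (\<lambda>z. fl_scale (if z = x then 1 else b) (fl_gen z))" for b
  have "\<sigma> b v = v" if "b \<noteq> 0" for b
  proof -
    have \<sigma>: "\<sigma> b \<in> Units free_lie_End"
      unfolding \<sigma>_def using that by (intro diagonal_Units) simp
    have "\<sigma> b \<circ> ?e = ?e"
      using fl_hom_Unit[OF \<sigma>] by (simp add: comp_single) (simp add: \<sigma>_def fl_lift_simps)
    then show ?thesis
      unfolding v_def by (rule Unit_comp_xi[OF fl_hom_single \<sigma>])
  qed
  moreover have "poly_curve fl_scale (\<lambda>b. \<sigma> b v)"
    unfolding \<sigma>_def
  proof (rule poly_curve_fl_lift)
    show "poly_curve fl_scale (\<lambda>b. fl_scale (if z = x then 1 else b) (fl_gen z))" for z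
      using poly_curve.shift[OF poly_curve.const, of fl_scale "fl_gen z"]
      by (cases "z = x") (simp_all add: poly_curve.const)
  qed
  ultimately have "\<sigma> 0 v = v"
    using free_lie.poly_curve_constant_at_0[OF inf] by blast
  \<comment> \<open>At \<open>b = 0\<close>, the one-parameter family of automorphisms degenerates to the projection.\<close>
  moreover have "\<sigma> 0 = ?e"
    unfolding \<sigma>_def single_def by (rule arg_cong[where f = fl_lift]) auto
  ultimately have ev: "?e v = v" by simp
  then obtain c where c: "v = fl_scale c (fl_gen x)"
    using single_gen_multiple by metis
  have "?e \<circ> ?e = ?e"
    by (simp add: comp_single fl_hom_single single_gen)
  then have "\<xi> ?e \<circ> \<xi> ?e = \<xi> ?e"
    using xi_comp[OF fl_hom_single fl_hom_single, of x "fl_gen x" x "fl_gen x"] by metis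
  then have "\<xi> ?e v = v" unfolding v_def by (simp add: fun_eq_iff)
  then have cv: "fl_scale c v = v"
    using c by (simp add: e fl_hom_simps[OF fl_hom_single] single_gen)
  show ?thesis
  proof (cases "c = 0")
    case True
    \<comment> \<open>By injectivity, this happens only if the projection is zero itself.\<close>
    then have "\<xi> ?e = \<xi> (single x 0)" using e c by (simp add: xi_zero)
    then have "?e = single x 0" by (rule xi_inj[OF fl_hom_single fl_hom_single])
    then show ?thesis by (simp add: xi_zero)
  next
    case False
    then have "v = fl_gen x" using cv c by (metis free_lie.scale_left_imp_eq)
    then show ?thesis using e by simp
  qed
qed

text \<open>The map on the free Lie algebra induced by \<open>\<xi>\<close> by way of the encoding of elements as rank one
  endomorphisms. It intertwines \<open>f\<close> and \<open>\<xi> f\<close> for every endomorphism \<open>f\<close> (lemma \<open>xi_action\<close>).\<close>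

definition action :: "'x \<Rightarrow> ('p, 'x) free_lie \<Rightarrow> ('p, 'x) free_lie"
  where "action x u = \<xi> (single x u) (fl_gen x)"

lemma xi_single: "\<xi> (single x u) = single x (action x u)"
proof -
  let ?e = "single x (fl_gen x) :: ('p, 'x) free_lie \<Rightarrow> _"
  have "single x u \<circ> ?e = single x u"
    by (simp add: comp_single fl_hom_single single_gen)
  then have "\<xi> (single x u) \<circ> ?e = \<xi> (single x u)"
    using xi_comp[OF fl_hom_single fl_hom_single, of x u x "fl_gen x"]
    unfolding xi_projection by simp
  then show ?thesis
    by (simp add: action_def comp_single fl_hom_xi fl_hom_single)
qed

lemma xi_action:
  assumes "fl_hom f"
  shows "\<xi> f (action x u) = action x (f u)"
proof -
  have "\<xi> f \<circ> \<xi> (single x u) = \<xi> (single x (f u))"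
    using xi_comp[OF assms fl_hom_single, of x u] by (simp add: comp_single assms)
  then show ?thesis by (simp add: action_def fun_eq_iff)
qed

lemma action_0: "action x 0 = 0"
  by (simp add: action_def xi_zero single_0)

lemma action_orbit:
  assumes "\<sigma> \<in> Units free_lie_End"
  shows "action x (\<sigma> (fl_gen x)) = \<sigma> (fl_gen x)"
  using xi_action[OF fl_hom_Unit[OF assms], of x "fl_gen x"]
  by (simp add: stable assms action_def xi_projection single_gen)

lemma action_gen: "action x (fl_gen y) = fl_gen y"
  using action_orbit[OF transpose_Units[of x y], of x] by (simp add: fl_lift_simps)

lemma xi_gen: "fl_hom f \<Longrightarrow> \<xi> f (fl_gen y) = action x (f (fl_gen y))"
  using xi_action[of f x "fl_gen y"] by (simp add: action_gen)

text \<open>An element \<open>w\<close> that is fixed by the action gives a law for it: \<open>action x (f w) = \<xi> f w\<close>, and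
  \<open>\<xi> f w\<close> is obtained from \<open>w\<close> on substituting \<open>action x (f y)\<close> for each generator \<open>y\<close>. The next
  three lemmas use this for \<open>a x\<close>, \<open>x + y\<close> and \<open>[y, z]\<close>, with \<open>f\<close> chosen to send the generators
  that occur to the given elements.\<close>

lemma action_scale: "action x (fl_scale a u) = fl_scale a (action x u)"
proof (cases "a = 0")
  case True
  then show ?thesis by (simp add: action_0)
next
  case False
  let ?f = "single x u"
  have "action x (fl_scale a (fl_gen x)) = fl_scale a (fl_gen x)"
    using action_orbit[OF diagonal_Units[of "\<lambda>_. a"]] False by (simp add: fl_lift_simps)
  then have "\<xi> ?f (fl_scale a (fl_gen x)) = action x (?f (fl_scale a (fl_gen x)))"
    using xi_action[OF fl_hom_single, of x u x "fl_scale a (fl_gen x)"] by simp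
  then show ?thesis
    by (simp add: xi_single fl_hom_simps[OF fl_hom_single] single_gen)
qed

lemma action_add:
  assumes "y \<noteq> x"
  shows "action x (u + v) = action x u + action x v"
proof -
  define f where "f = fl_lift (\<lambda>z. if z = x then u else v)"
  have f: "fl_hom f" "f (fl_gen x) = u" "f (fl_gen y) = v"
    using assms by (simp_all add: f_def fl_hom_lift fl_lift_gen)
  have "action x (fl_gen x + fl_gen y) = fl_gen x + fl_gen y"
    using action_orbit[OF transvection_Units, of x "fl_gen y" x] assms by (simp add: fl_lift_simps)
  then have "\<xi> f (fl_gen x + fl_gen y) = action x (f (fl_gen x + fl_gen y))"
    using xi_action[OF f(1), of x "fl_gen x + fl_gen y"] by simp
  then show ?thesis
    by (simp add: fl_hom_simps[OF f(1)] fl_hom_simps[OF fl_hom_xi[OF f(1)]] f xi_gen[where x = x])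
qed

text \<open>Here a third generator is needed: \<open>x + [y, z]\<close> is the image of \<open>x\<close> under an automorphism, and
  by additivity it suffices that the action fixes this sum.\<close>

lemma action_bracket:
  assumes "x \<noteq> y" "y \<noteq> z" "z \<noteq> x"
  shows "action x (fl_bracket u v) = fl_bracket (action x u) (action x v)"
proof -
  define f where "f = fl_lift (\<lambda>t. if t = y then u else v)"
  have f: "fl_hom f" "f (fl_gen y) = u" "f (fl_gen z) = v"
    using assms by (simp_all add: f_def fl_hom_lift fl_lift_gen)
  let ?b = "fl_bracket (fl_gen y) (fl_gen z) :: ('p, 'x) free_lie"
  have "action x (fl_gen x + ?b) = fl_gen x + ?b"
    using action_orbit[OF transvection_Units, of x ?b x] assms by (simp add: fl_lift_simps)
  then have "action x ?b = ?b"
    using assms by (simp add: action_add[of y x] action_gen)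
  then have "\<xi> f ?b = action x (f ?b)"
    using xi_action[OF f(1), of x ?b] by simp
  then show ?thesis
    by (simp add: fl_hom_simps[OF f(1)] fl_hom_simps[OF fl_hom_xi[OF f(1)]] f xi_gen[where x = x])
qed

lemma xi_identity:
  fixes x y z :: 'x
  assumes "x \<noteq> y" "y \<noteq> z" "z \<noteq> x" "fl_hom f"
  shows "\<xi> f = f"
proof -
  have "fl_hom (action x)"
    using assms by (intro fl_homI action_scale action_add[of y] action_bracket) auto
  moreover have "fl_hom id" by (rule fl_homI) simp_all
  ultimately have "action x = id"
    by (rule fl_hom_eqI) (simp add: action_gen)
  then show ?thesis
    by (intro fl_hom_eqI) (simp_all add: assms fl_hom_xi xi_gen[where x = x])
qed

end

theorem proposition2:
  fixes \<xi> :: "(('p::field, 'x::finite) free_lie \<Rightarrow> ('p, 'x) free_lie) \<Rightarrow>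
              (('p, 'x) free_lie \<Rightarrow> ('p, 'x) free_lie)"
  assumes "infinite (UNIV :: 'p set)"
    and "CARD('x) > 2"
    and "\<xi> \<in> iso free_lie_End free_lie_End"
    and "\<forall>\<sigma>\<in>Units free_lie_End. \<xi> \<sigma> = \<sigma>"
  shows "\<forall>\<phi>\<in>carrier free_lie_End. \<xi> \<phi> = \<phi>"
proof -
  interpret stable_automorphism \<xi>
    using assms by unfold_locales auto
  obtain T :: "'x set" where "card T = 3"
    using obtain_subset_with_card_n[of 3 "UNIV :: 'x set"] assms(2) by auto
  then obtain x y z :: 'x where "x \<noteq> y" "y \<noteq> z" "z \<noteq> x"
    by (auto simp: card_3_iff)
  then show ?thesis using xi_identity by auto
qed

end
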